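(* Let $G=(V,E)$ be a graph with maximum degree $\Delta(G)\ge 1$ and let $X\subseteq V$. Then \[\left\lceil\frac{Z(G;X)}{\Delta(G)}\right\rceil\le \gamma_P(G;X),\] and this bound is tight, i.e., there exist a graph $G$ with $\Delta(G)\ge 1$ and a set $X\subseteq V(G)$ for which equality holds.
   Context: All graphs are finite, simple and undirected. $N(v)$ denotes the set of neighbors of $v$, $N[v]=N(v)\cup\{v\}$, and $N[S]=\bigcup_{v\in S}N[v]$ for $S\subseteq V$. For $S\subseteq V$, the set $PD(S)$ is defined by: initially $PD(S)=N[S]$; while there exists $v\in PD(S)$ with $|N(v)\setminus PD(S)|=1$, replace $PD(S)$ by $PD(S)\cup N(v)$. $S$ is a power dominating set of $G$ if at the end $PD(S)=V$. For $X\subseteq V$, $\gamma_P(G;X)$ is the minimum cardinality of a power dominating set of $G$ containing $X$. Zero forcing: given a set $B$ of blue vertices (others white), the color change rule says that if a blue vertex $u$ has exactly one white neighbor $w$, then $w$ is colored blue. The closure $cl(B)$ is the set of blue vertices after applying this rule until no more changes are possible; $B$ is a zero forcing set if $cl(B)=V$. $Z(G;X)$ is the minimum cardinality of a zero forcing set of $G$ containing $X$. $\Delta(G)$ is the maximum degree of $G$. *)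

theory Defs
  imports Complex_Main
begin

definition simple_graph :: "'a set \<Rightarrow> 'a set set \<Rightarrow> bool" where
  "simple_graph V E \<longleftrightarrow> finite V \<and> (\<forall>e\<in>E. e \<subseteq> V \<and> card e = 2)"

definition nbhd :: "'a set set \<Rightarrow> 'a \<Rightarrow> 'a set" where
  "nbhd E v = {u. {v, u} \<in> E}"

definition closed_nbhd :: "'a set set \<Rightarrow> 'a \<Rightarrow> 'a set" where
  "closed_nbhd E v = insert v (nbhd E v)"

definition closed_nbhd_set :: "'a set set \<Rightarrow> 'a set \<Rightarrow> 'a set" where
  "closed_nbhd_set E S = (\<Union>v\<in>S. closed_nbhd E v)"

text \<open>The inserted 0 only matters for the graph without vertices.\<close>

definition max_degree :: "'a set \<Rightarrow> 'a set set \<Rightarrow> nat" where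
  "max_degree V E = Max (insert 0 ((\<lambda>v. card (nbhd E v)) ` V))"

text \<open>
  Both processes are nondeterministic loops on vertex sets. In a finite graph every run
  terminates and all runs end in the same set (lemmas \<open>PD_final\<close>, \<open>PD_eqI\<close>,
  \<open>cl_final\<close>, \<open>cl_eqI\<close> below), so the description operator below is well defined there.
\<close>

definition terminal :: "('b \<Rightarrow> 'b \<Rightarrow> bool) \<Rightarrow> 'b \<Rightarrow> 'b \<Rightarrow> bool" where
  "terminal step a b \<longleftrightarrow> step\<^sup>*\<^sup>* a b \<and> (\<nexists>c. step b c)"

definition pd_step :: "'a set set \<Rightarrow> 'a set \<Rightarrow> 'a set \<Rightarrow> bool" where
  "pd_step E P P' \<longleftrightarrow> (\<exists>v\<in>P. card (nbhd E v - P) = 1 \<and> P' = P \<union> nbhd E v)"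

definition PD :: "'a set set \<Rightarrow> 'a set \<Rightarrow> 'a set" where
  "PD E S = (THE P. terminal (pd_step E) (closed_nbhd_set E S) P)"

definition power_dominating_set :: "'a set \<Rightarrow> 'a set set \<Rightarrow> 'a set \<Rightarrow> bool" where
  "power_dominating_set V E S \<longleftrightarrow> S \<subseteq> V \<and> PD E S = V"

definition power_domination_number :: "'a set \<Rightarrow> 'a set set \<Rightarrow> 'a set \<Rightarrow> nat" where
  "power_domination_number V E X = Min (card ` {S. power_dominating_set V E S \<and> X \<subseteq> S})"

definition color_change :: "'a set set \<Rightarrow> 'a set \<Rightarrow> 'a set \<Rightarrow> bool" where
  "color_change E B B' \<longleftrightarrow> (\<exists>u\<in>B. \<exists>w. nbhd E u - B = {w} \<and> B' = insert w B)"

definition cl :: "'a set set \<Rightarrow> 'a set \<Rightarrow> 'a set" where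
  "cl E B = (THE C. terminal (color_change E) B C)"

definition zero_forcing_set :: "'a set \<Rightarrow> 'a set set \<Rightarrow> 'a set \<Rightarrow> bool" where
  "zero_forcing_set V E B \<longleftrightarrow> B \<subseteq> V \<and> cl E B = V"

definition zero_forcing_number :: "'a set \<Rightarrow> 'a set set \<Rightarrow> 'a set \<Rightarrow> nat" where
  "zero_forcing_number V E X = Min (card ` {B. zero_forcing_set V E B \<and> X \<subseteq> B})"

lemma nbhd_subset: "simple_graph V E \<Longrightarrow> nbhd E v \<subseteq> V"
  unfolding simple_graph_def nbhd_def by auto

lemma closed_nbhd_set_subset:
  "simple_graph V E \<Longrightarrow> S \<subseteq> V \<Longrightarrow> closed_nbhd_set E S \<subseteq> V"
  using nbhd_subset unfolding closed_nbhd_set_def closed_nbhd_def by fastforce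

lemma pd_step_eq: "pd_step E = color_change E"
proof (intro ext)
  fix P P'
  have "P \<union> nbhd E v = insert w P" if "nbhd E v - P = {w}" for v w
    using that by auto
  then show "pd_step E P P' = color_change E P P'"
    unfolding pd_step_def color_change_def One_nat_def card_1_singleton_iff by metis
qed

lemma ex_terminal_color_change:
  assumes "simple_graph V E" "B \<subseteq> V"
  shows "\<exists>C. terminal (color_change E) B C"
  using assms(2)
proof (induction "card (V - B)" arbitrary: B rule: less_induct)
  case less
  show ?case
  proof (cases "\<exists>C. color_change E B C")
    case False
    then show ?thesis unfolding terminal_def by blast
  next
    case True
    then obtain C where C: "color_change E B C" by blast
    then obtain u w where w: "nbhd E u - B = {w}" "C = insert w B"
      unfolding color_change_def by blast
    have wV: "w \<in> V" "w \<notin> B" using w(1) nbhd_subset[OF assms(1), of u] by auto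
    have "finite V" using assms(1) by (simp add: simple_graph_def)
    moreover have "V - C \<subset> V - B" using wV w(2) by blast
    ultimately have "card (V - C) < card (V - B)" by (simp add: psubset_card_mono)
    moreover have "C \<subseteq> V" using w(2) wV less.prems by auto
    ultimately obtain D where "terminal (color_change E) C D" using less.hyps by blast
    then show ?thesis using C unfolding terminal_def
      by (meson converse_rtranclp_into_rtranclp)
  qed
qed

lemma terminal_color_change_subset:
  assumes "(color_change E)\<^sup>*\<^sup>* B C" "B \<subseteq> D" "\<nexists>D'. color_change E D D'"
  shows "C \<subseteq> D"
  using assms(1)
proof (induction rule: rtranclp_induct)
  case base
  show ?case by fact
next
  case (step P Q)
  from step.hyps(2) obtain u w where u: "u \<in> P" "nbhd E u - P = {w}" "Q = insert w P"
    unfolding color_change_def by blast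
  have "w \<in> D"
  proof (rule ccontr)
    assume "w \<notin> D"
    then have "nbhd E u - D = {w}" using u step.IH by blast
    then show False using u(1) step.IH assms(3) unfolding color_change_def by blast
  qed
  then show ?case using u(3) step.IH by simp
qed

lemma terminal_color_change_unique:
  assumes "terminal (color_change E) B C" "terminal (color_change E) B D"
  shows "C = D"
proof -
  have incr: "B \<subseteq> P" if "(color_change E)\<^sup>*\<^sup>* B P" for P
    using that by (induction rule: rtranclp_induct) (auto simp: color_change_def)
  show ?thesis
    using assms incr terminal_color_change_subset unfolding terminal_def
    by (metis subset_antisym)
qed

lemma cl_eqI: "terminal (color_change E) B C \<Longrightarrow> cl E B = C"
  unfolding cl_def by (metis terminal_color_change_unique the_equality)

lemma cl_final: "simple_graph V E \<Longrightarrow> B \<subseteq> V \<Longrightarrow> terminal (color_change E) B (cl E B)"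
  using ex_terminal_color_change cl_eqI by metis

lemma PD_eq_cl: "PD E S = cl E (closed_nbhd_set E S)"
  unfolding PD_def cl_def pd_step_eq ..

lemma PD_eqI: "terminal (pd_step E) (closed_nbhd_set E S) P \<Longrightarrow> PD E S = P"
  unfolding PD_eq_cl pd_step_eq by (rule cl_eqI)

lemma PD_final:
  "simple_graph V E \<Longrightarrow> S \<subseteq> V \<Longrightarrow> terminal (pd_step E) (closed_nbhd_set E S) (PD E S)"
  unfolding PD_eq_cl pd_step_eq by (rule cl_final) (auto dest: closed_nbhd_set_subset)

lemma zero_forcing_set_univ:
  assumes "simple_graph V E"
  shows "zero_forcing_set V E V"
proof -
  have "nbhd E u - V = {}" for u using nbhd_subset[OF assms] by blast
  then have "terminal (color_change E) V V"
    unfolding terminal_def color_change_def by (metis insert_not_empty rtranclp.rtrancl_refl)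
  then show ?thesis unfolding zero_forcing_set_def by (simp add: cl_eqI)
qed

lemma power_dominating_set_univ:
  assumes "simple_graph V E"
  shows "power_dominating_set V E V"
proof -
  have "closed_nbhd_set E V = V"
    using closed_nbhd_set_subset[OF assms subset_refl]
    unfolding closed_nbhd_set_def closed_nbhd_def by blast
  then show ?thesis using zero_forcing_set_univ[OF assms]
    unfolding power_dominating_set_def zero_forcing_set_def PD_eq_cl by simp
qed

end

theory Submission
  imports Defs
begin

text \<open>
  Let \<open>S\<close> be a power dominating set. For every \<open>v \<in> S\<close> take \<open>v\<close> together with all of its
  neighbours except one. This gives a set \<open>B \<supseteq> S\<close> with at most \<open>\<Delta>(G)\<close> vertices per
  element of \<open>S\<close>. Each \<open>v \<in> S\<close> has at most one white neighbour, so it forces the omitted one;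
  hence the closure of \<open>B\<close> contains \<open>N[S]\<close>, from which everything is forced.
  Equality holds for a single edge with \<open>X = V\<close>.
\<close>

lemma finite_nbhd: "simple_graph V E \<Longrightarrow> finite (nbhd E v)"
  by (meson nbhd_subset finite_subset simple_graph_def)

lemma card_nbhd_le_max_degree:
  assumes "simple_graph V E" "v \<in> V"
  shows "card (nbhd E v) \<le> max_degree V E"
  using assms unfolding max_degree_def simple_graph_def by (intro Max_ge) auto

lemma subset_cl:
  assumes "simple_graph V E" "B \<subseteq> V"
  shows "B \<subseteq> cl E B"
proof -
  have "(color_change E)\<^sup>*\<^sup>* B (cl E B)"
    using cl_final[OF assms] unfolding terminal_def by blast
  then show ?thesis
    by (induction rule: rtranclp_induct) (auto simp: color_change_def)
qed

lemma cl_stable: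
  assumes "simple_graph V E" "B \<subseteq> V"
  shows "\<not> color_change E (cl E B) C"
  using cl_final[OF assms] unfolding terminal_def by blast

text \<open>Together with \<open>subset_cl\<close> and \<open>cl_stable\<close>, this makes
  \<open>cl E B\<close> the least stable superset of \<open>B\<close>. The proofs below use this
  description instead of following the order of forces.\<close>

lemma cl_least:
  assumes "simple_graph V E" "B \<subseteq> V" "B \<subseteq> D" "\<nexists>D'. color_change E D D'"
  shows "cl E B \<subseteq> D"
  using terminal_color_change_subset[of E B "cl E B" D] cl_final[OF assms(1,2)] assms(3,4)
  unfolding terminal_def by blast

lemma cl_subset_vertices:
  assumes "simple_graph V E" "B \<subseteq> V"
  shows "cl E B \<subseteq> V"
proof (rule cl_least[OF assms assms(2)])
  show "\<nexists>D'. color_change E V D'"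
    using nbhd_subset[OF assms(1)] unfolding color_change_def by blast
qed

lemma zero_forcing_set_of_power_dominating_set:
  assumes G: "simple_graph V E" and \<Delta>: "max_degree V E \<ge> 1"
    and S: "power_dominating_set V E S"
  shows "\<exists>B. zero_forcing_set V E B \<and> S \<subseteq> B \<and> card B \<le> max_degree V E * card S"
proof -
  \<comment> \<open>By \<open>PD_eq_cl\<close>, power domination by \<open>S\<close> is zero forcing
    started from N[S].\<close>
  have SV: "S \<subseteq> V" and PDS: "cl E (closed_nbhd_set E S) = V"
    using S by (auto simp: power_dominating_set_def PD_eq_cl)
  have finS: "finite S" using SV G finite_subset by (auto simp: simple_graph_def)
  \<comment> \<open>The neighbour to omit. If \<open>v\<close> is isolated, the choice is arbitrary
    but harmless: removing it from the empty set gives \<open>A v = {v}\<close>.\<close>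
  define w where "w v = (SOME u. u \<in> nbhd E v)" for v
  define A where "A v = insert v (nbhd E v - {w v})" for v
  define B where "B = (\<Union>v\<in>S. A v)"
  have "card (A v) \<le> max_degree V E" if "v \<in> S" for v
  proof (cases "nbhd E v = {}")
    case True
    \<comment> \<open>Here \<open>A v\<close> has one element, which is where \<Delta>(G) \<ge> 1
      enters.\<close>
    then show ?thesis using \<Delta> by (simp add: A_def)
  next
    case False
    then have "w v \<in> nbhd E v" by (simp add: w_def some_in_eq)
    then have "Suc (card (nbhd E v - {w v})) = card (nbhd E v)"
      using finite_nbhd[OF G] by (metis card_Suc_Diff1)
    \<comment> \<open>Adding \<open>v\<close> makes up for dropping \<open>w v\<close>.\<close>
    then have "card (A v) \<le> card (nbhd E v)"
      using card_insert_le_m1[of "card (nbhd E v)" "nbhd E v - {w v}" v] by (simp add: A_def)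
    also have "\<dots> \<le> max_degree V E"
      using card_nbhd_le_max_degree[OF G] that SV by blast
    finally show ?thesis .
  qed
  then have "(\<Sum>v\<in>S. card (A v)) \<le> max_degree V E * card S"
    using sum_bounded_above[of S "\<lambda>v. card (A v)" "max_degree V E"] by (simp add: mult.commute)
  then have cardB: "card B \<le> max_degree V E * card S"
    using card_UN_le[OF finS, of A] unfolding B_def by linarith
  have BV: "B \<subseteq> V" using SV nbhd_subset[OF G] unfolding B_def A_def by blast
  have SB: "S \<subseteq> B" unfolding B_def A_def by blast
  have B_cl: "B \<subseteq> cl E B" using subset_cl[OF G BV] .
  have "nbhd E v \<subseteq> cl E B" if v: "v \<in> S" for v
  proof (rule ccontr)
    assume "\<not> nbhd E v \<subseteq> cl E B"
    \<comment> \<open>\<open>B\<close> already contains every other neighbour of \<open>v\<close>.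
      If \<open>w v\<close> were missing from the closure, \<open>v\<close> would force it,
      contradicting stability.\<close>
    moreover have "nbhd E v - cl E B \<subseteq> {w v}" using v B_cl unfolding B_def A_def by blast
    ultimately have "nbhd E v - cl E B = {w v}" by blast
    then have "color_change E (cl E B) (insert (w v) (cl E B))"
      using v SB B_cl unfolding color_change_def by blast
    then show False using cl_stable[OF G BV] by blast
  qed
  then have "closed_nbhd_set E S \<subseteq> cl E B"
    using SB B_cl unfolding closed_nbhd_set_def closed_nbhd_def by blast
  \<comment> \<open>The stable set \<open>cl E B\<close> contains N[S], hence also the closure of
    N[S], which is \<open>V\<close>.\<close>
  then have "V \<subseteq> cl E B"
    using cl_least[OF G closed_nbhd_set_subset[OF G SV]] cl_stable[OF G BV] PDS by blast
  then have "zero_forcing_set V E B"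
    using cl_subset_vertices[OF G BV] BV unfolding zero_forcing_set_def by blast
  with SB cardB show ?thesis by blast
qed

text \<open>The minimum runs over a finite family of subsets of \<open>V\<close>, nonempty because
  \<open>V\<close> itself belongs to it.\<close>

lemma power_domination_number_attained:
  assumes "simple_graph V E" "X \<subseteq> V"
  shows "\<exists>S. power_dominating_set V E S \<and> X \<subseteq> S \<and> card S = power_domination_number V E X"
proof -
  let ?F = "{S. power_dominating_set V E S \<and> X \<subseteq> S}"
  have "finite ?F"
    using assms(1) by (auto simp: simple_graph_def power_dominating_set_def
        intro: finite_subset[of _ "Pow V"])
  moreover have "?F \<noteq> {}" using power_dominating_set_univ[OF assms(1)] assms(2) by blast
  ultimately have "Min (card ` ?F) \<in> card ` ?F" by (intro Min_in) auto
  then show ?thesis unfolding power_domination_number_def by auto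
qed

lemma zero_forcing_number_le:
  assumes "simple_graph V E" "zero_forcing_set V E B" "X \<subseteq> B"
  shows "zero_forcing_number V E X \<le> card B"
proof -
  have "finite {B. zero_forcing_set V E B \<and> X \<subseteq> B}"
    using assms(1) by (auto simp: simple_graph_def zero_forcing_set_def
        intro: finite_subset[of _ "Pow V"])
  then show ?thesis using assms unfolding zero_forcing_number_def by (intro Min_le) auto
qed

lemma zero_forcing_number_le_max_degree_mult:
  assumes "simple_graph V E" "max_degree V E \<ge> 1" "X \<subseteq> V"
  shows "zero_forcing_number V E X \<le> max_degree V E * power_domination_number V E X"
proof -
  obtain S where S: "power_dominating_set V E S" "X \<subseteq> S"
      "card S = power_domination_number V E X"
    using power_domination_number_attained[OF assms(1,3)] by blast
  obtain B where B: "zero_forcing_set V E B" "S \<subseteq> B" "card B \<le> max_degree V E * card S"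
    using zero_forcing_set_of_power_dominating_set[OF assms(1,2) S(1)] by blast
  \<comment> \<open>The prescribed set is inherited through X \<subseteq> S \<subseteq> B.\<close>
  have "zero_forcing_number V E X \<le> card B"
    using S(2) B(2) by (intro zero_forcing_number_le[OF assms(1) B(1)]) (rule order_trans)
  also have "\<dots> \<le> max_degree V E * power_domination_number V E X"
    using B(3) S(3) by simp
  finally show ?thesis .
qed

text \<open>With X = V the only admissible set is \<open>V\<close>. This and its power domination
  analogue settle the tightness example without running either process.\<close>

lemma zero_forcing_number_vertices:
  assumes "simple_graph V E"
  shows "zero_forcing_number V E V = card V"
proof -
  have "{B. zero_forcing_set V E B \<and> V \<subseteq> B} = {V}"
    using zero_forcing_set_univ[OF assms] unfolding zero_forcing_set_def by blast
  then show ?thesis by (simp add: zero_forcing_number_def)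
qed

lemma power_domination_number_vertices:
  assumes "simple_graph V E"
  shows "power_domination_number V E V = card V"
proof -
  have "{S. power_dominating_set V E S \<and> V \<subseteq> S} = {V}"
    using power_dominating_set_univ[OF assms] unfolding power_dominating_set_def by blast
  then show ?thesis by (simp add: power_domination_number_def)
qed

lemma max_degree_single_edge:
  assumes "a \<noteq> b"
  shows "max_degree {a, b} {{a, b}} = 1"
proof -
  have "nbhd {{a, b}} a = {b}" "nbhd {{a, b}} b = {a}"
    using assms by (auto simp: nbhd_def doubleton_eq_iff)
  then show ?thesis by (simp add: max_degree_def)
qed

theorem theorem3p16:
  shows "(\<forall>(V :: 'a set) E X. simple_graph V E \<and> max_degree V E \<ge> 1 \<and> X \<subseteq> V \<longrightarrow>
      \<lceil>real (zero_forcing_number V E X) / real (max_degree V E)\<rceil>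
        \<le> int (power_domination_number V E X)) \<and>
    (\<exists>(V :: nat set) E X. simple_graph V E \<and> max_degree V E \<ge> 1 \<and> X \<subseteq> V \<and>
      \<lceil>real (zero_forcing_number V E X) / real (max_degree V E)\<rceil>
        = int (power_domination_number V E X))"
proof (intro conjI allI impI)
  fix V :: "'a set" and E X
  assume A: "simple_graph V E \<and> max_degree V E \<ge> 1 \<and> X \<subseteq> V"
  then have "real (zero_forcing_number V E X)
      \<le> real (max_degree V E) * real (power_domination_number V E X)"
    using zero_forcing_number_le_max_degree_mult[of V E X] by (metis of_nat_le_iff of_nat_mult)
  then show "\<lceil>real (zero_forcing_number V E X) / real (max_degree V E)\<rceil>
      \<le> int (power_domination_number V E X)"
    \<comment> \<open>The right-hand side is an integer, so bounding the quotient itself suffices;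
      \<Delta>(G) > 0 allows clearing the denominator.\<close>
    using A by (intro ceiling_le) (simp add: divide_le_eq mult.commute)
next
  \<comment> \<open>For a single edge \<Delta>(G) = 1, so with X = V both sides equal
    \<open>card ?V\<close>.\<close>
  let ?V = "{0, 1} :: nat set"
  have G: "simple_graph ?V {?V}" by (simp add: simple_graph_def)
  have \<Delta>: "max_degree ?V {?V} = 1" by (rule max_degree_single_edge) simp
  have "\<lceil>real (zero_forcing_number ?V {?V} ?V) / real (max_degree ?V {?V})\<rceil>
      = int (power_domination_number ?V {?V} ?V)"
    unfolding zero_forcing_number_vertices[OF G] power_domination_number_vertices[OF G] \<Delta> by simp
  with G \<Delta> have "simple_graph ?V {?V} \<and> max_degree ?V {?V} \<ge> 1 \<and> ?V \<subseteq> ?V \<and>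
      \<lceil>real (zero_forcing_number ?V {?V} ?V) / real (max_degree ?V {?V})\<rceil>
        = int (power_domination_number ?V {?V} ?V)"
    by (simp only: order_refl simp_thms)
  then show "\<exists>(V :: nat set) E X. simple_graph V E \<and> max_degree V E \<ge> 1 \<and> X \<subseteq> V \<and>
      \<lceil>real (zero_forcing_number V E X) / real (max_degree V E)\<rceil>
        = int (power_domination_number V E X)"
    by (intro exI)
qed

end
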